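(* Let $0\le c<1/2$ and let $(p_n)_{n\ge1}$ be a sequence in $[0,1]$ with $p_n=\Omega(n^{-c})$, and for each $n$ let $G_n$ be a random directed acyclic graph drawn from $D(n,p_n)$. Then for all $\epsilon>0$ and $\delta>0$ there exists $N$ such that for all $n\ge N$, $$P[\mathrm{GAPCW}(G_n)<1+\delta]>1-\epsilon.$$
   Context: $p_n=\Omega(n^{-c})$ means there exist $k>0$ and $n_0$ with $p_n \ge k n^{-c}$ for all $n\ge n_0$. The distribution $D(n,p)$ on directed acyclic graphs with vertex set $\{1,\dots,n\}$ is obtained by including each of the $\binom{n}{2}$ pairs $\{i,j\}$ independently with probability $p$ and orienting each included edge from $i$ to $j$ when $i<j$. For a directed acyclic graph $G=(V,E)$ with $|V|=n$, a layout is a bijection $\phi:V\to\{1,\dots,n\}$ such that $\phi(u)<\phi(v)$ for every directed edge $(u,v)\in E$ (a topological ordering). For $1\le i\le n$, $\theta(i,\phi,G)$ is the number of edges $(u,v)\in E$ with $\phi(u)\le i<\phi(v)$. Define $\mathrm{CW}(G,\phi)=\max_{1\le i\le n}\theta(i,\phi,G)$, $\mathrm{MINCW}(G)=\min_\phi\mathrm{CW}(G,\phi)$, $\mathrm{MAXCW}(G)=\max_\phi\mathrm{CW}(G,\phi)$, with min and max over all layouts (topological orderings) $\phi$ of $G$, and $\mathrm{GAPCW}(G)=\mathrm{MAXCW}(G)/\mathrm{MINCW}(G)$. *)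

theory Defs
  imports "HOL-Probability.Probability" "Graph_Theory.Pair_Digraph"
begin

text \<open>
  The unordered pair \<open>{i, j}\<close> with \<open>i < j\<close> is represented by the ordered pair \<open>(i, j)\<close>, which
  is also the arc it gives rise to when it is included.
\<close>

definition dag_pairs :: "nat \<Rightarrow> (nat \<times> nat) set" where
  "dag_pairs n = {(i, j). 1 \<le> i \<and> i < j \<and> j \<le> n}"

definition random_dag :: "nat \<Rightarrow> real \<Rightarrow> nat pair_pre_digraph pmf" where
  "random_dag n p =
     map_pmf (\<lambda>X. \<lparr> pverts = {1..n}, parcs = {e \<in> dag_pairs n. X e} \<rparr>)
       (Pi_pmf (dag_pairs n) False (\<lambda>_. bernoulli_pmf p))"

definition layout :: "'a pair_pre_digraph \<Rightarrow> ('a \<Rightarrow> nat) \<Rightarrow> bool" where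
  "layout G \<phi> \<longleftrightarrow>
     bij_betw \<phi> (pverts G) {1..card (pverts G)} \<and> (\<forall>(u, v) \<in> parcs G. \<phi> u < \<phi> v)"

definition \<theta> :: "nat \<Rightarrow> ('a \<Rightarrow> nat) \<Rightarrow> 'a pair_pre_digraph \<Rightarrow> nat" where
  "\<theta> i \<phi> G = card {(u, v) \<in> parcs G. \<phi> u \<le> i \<and> i < \<phi> v}"

definition CW :: "'a pair_pre_digraph \<Rightarrow> ('a \<Rightarrow> nat) \<Rightarrow> nat" where
  "CW G \<phi> = Max ((\<lambda>i. \<theta> i \<phi> G) ` {1..card (pverts G)})"

text \<open>
  Layouts are unconstrained outside the vertex set, so there may be infinitely many of them as
  functions, but on a finite graph they give only finitely many cutwidths
  (\<open>finite_CW_layouts\<close> below), so \<open>Min\<close> and \<open>Max\<close> are meaningful.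
\<close>

definition MINCW :: "'a pair_pre_digraph \<Rightarrow> nat" where
  "MINCW G = Min (CW G ` {\<phi>. layout G \<phi>})"

definition MAXCW :: "'a pair_pre_digraph \<Rightarrow> nat" where
  "MAXCW G = Max (CW G ` {\<phi>. layout G \<phi>})"

text \<open>The quotient is meaningful only if \<open>MINCW G > 0\<close>; for graphs without arcs it is \<open>0 / 0 = 0\<close>.\<close>

definition GAPCW :: "'a pair_pre_digraph \<Rightarrow> real" where
  "GAPCW G = real (MAXCW G) / real (MINCW G)"

lemma finite_dag_pairs: "finite (dag_pairs n)"
  by (rule finite_subset[of _ "{1..n} \<times> {1..n}"]) (auto simp: dag_pairs_def)

lemma finite_CW_layouts:
  assumes "finite (parcs G)" and "finite (pverts G)" and "pverts G \<noteq> {}"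
  shows "finite (CW G ` {\<phi>. layout G \<phi>})"
proof (rule finite_subset)
  have th: "\<theta> i \<phi> G \<le> card (parcs G)" for i \<phi>
    unfolding \<theta>_def by (rule card_mono) (use assms in auto)
  have "{1..card (pverts G)} \<noteq> {}"
    using assms by (simp add: Suc_le_eq card_gt_0_iff)
  then show "CW G ` {\<phi>. layout G \<phi>} \<subseteq> {..card (parcs G)}"
    by (auto simp: CW_def th)
qed simp

lemma set_random_dag:
  assumes "G \<in> set_pmf (random_dag n p)"
  shows "pverts G = {1..n}" and "parcs G \<subseteq> dag_pairs n" and "acyclic (parcs G)"
    and "layout G id"
proof -
  show *: "pverts G = {1..n}" "parcs G \<subseteq> dag_pairs n"
    using assms by (auto simp: random_dag_def)
  have "parcs G \<subseteq> {(i, j). i < j}"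
    using *(2) by (auto simp: dag_pairs_def)
  then show "acyclic (parcs G)"
    by (meson acyclic_subset wf_acyclic wf_less)
  show "layout G id"
    using * by (auto simp: layout_def dag_pairs_def)
qed

end

theory Submission
  imports Defs "HOL-Real_Asymp.Real_Asymp"
begin

text \<open>
  In a topological ordering every arc between the first \<open>i\<close> vertices and the rest points forward,
  so \<open>\<theta>\<close> counts the edges of an undirected cut, and each such count is binomial with mean
  \<open>p i (n - i)\<close>. By Hoeffding's inequality one fixed cut deviates from its mean by more than
  \<open>\<eta> p n\<^sup>2\<close> with probability at most \<open>2 exp (- 8 \<eta>\<^sup>2 p\<^sup>2 n\<^sup>2)\<close>. Since \<open>p\<^sup>2 n \<longlonglongrightarrow> \<infinity>\<close>, exactly because
  \<open>c < 1/2\<close>, this beats the \<open>2 ^ n\<close> of a union bound over all vertex sets. So with high probability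
  every layout has cutwidth \<open>(1/4 \<plusminus> 2 \<eta>) p n\<^sup>2\<close>.
\<close>

section \<open>Distribution of the size of one fixed cut\<close>

definition cut_arcs :: "'a pair_pre_digraph \<Rightarrow> 'a set \<Rightarrow> ('a \<times> 'a) set" where
  "cut_arcs G S = {(u, v) \<in> parcs G. u \<in> S \<longleftrightarrow> v \<notin> S}"

text \<open>The candidates for cut arcs. They do not depend on the random graph, so their number is
  the number of Bernoulli trials.\<close>

definition cut_pairs :: "nat \<Rightarrow> nat set \<Rightarrow> (nat \<times> nat) set" where
  "cut_pairs n S = {(i, j) \<in> dag_pairs n. i \<in> S \<longleftrightarrow> j \<notin> S}"

lemma card_cut_pairs:
  assumes "S \<subseteq> {1..n}"
  shows "card (cut_pairs n S) = card S * (n - card S)"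
proof -
  \<comment> \<open>Sorting sends a vertex of \<open>S\<close> and a vertex outside it to an
    increasing pair; membership in \<open>S\<close> tells afterwards which entry was which.\<close>
  let ?f = "\<lambda>(a, b). (min a b, max a b)"
  have "bij_betw ?f (S \<times> ({1..n} - S)) (cut_pairs n S)"
    unfolding bij_betw_def
  proof
    show "inj_on ?f (S \<times> ({1..n} - S))"
      by (auto simp: inj_on_def min_def max_def split: if_splits)
    show "?f ` (S \<times> ({1..n} - S)) = cut_pairs n S"
    proof (intro equalityI subsetI)
      fix e assume "e \<in> ?f ` (S \<times> ({1..n} - S))"
      then obtain a b where ab: "a \<in> S" "b \<in> {1..n}" "b \<notin> S" "e = (min a b, max a b)"
        by auto
      have "a \<in> {1..n}" "a \<noteq> b" using ab assms by auto
      with ab show "e \<in> cut_pairs n S"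
        by (auto simp: cut_pairs_def dag_pairs_def min_def max_def)
    next
      fix e assume e: "e \<in> cut_pairs n S"
      obtain i j where ij: "e = (i, j)" by force
      with e have *: "1 \<le> i" "i < j" "j \<le> n" "i \<in> S \<longleftrightarrow> j \<notin> S"
        by (auto simp: cut_pairs_def dag_pairs_def)
      show "e \<in> ?f ` (S \<times> ({1..n} - S))"
      proof (cases "i \<in> S")
        case True
        with * show ?thesis by (intro image_eqI[of _ _ "(i, j)"]) (auto simp: ij)
      next
        case False
        with * show ?thesis by (intro image_eqI[of _ _ "(j, i)"]) (auto simp: ij)
      qed
    qed
  qed
  then have "card (cut_pairs n S) = card (S \<times> ({1..n} - S))"
    by (simp add: bij_betw_same_card)
  also have "\<dots> = card S * (n - card S)"
    using assms finite_subset[OF assms] by (simp add: card_cartesian_product card_Diff_subset)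
  finally show ?thesis .
qed

lemma map_pmf_card_Pi_pmf_bernoulli:
  assumes "finite A" and "B \<subseteq> A" and "p \<in> {0..1}"
  shows "map_pmf (\<lambda>f. card {x \<in> B. f x}) (Pi_pmf A False (\<lambda>_. bernoulli_pmf p))
    = binomial_pmf (card B) p"
proof -
  have "binomial_pmf (card B) p
      = map_pmf (\<lambda>f. card {x \<in> B. f x}) (Pi_pmf B False (\<lambda>_. bernoulli_pmf p))"
    by (rule binomial_pmf_altdef') (use assms finite_subset in auto)
  also have "\<dots> = map_pmf (\<lambda>f. card {x \<in> B. f x}) (Pi_pmf A False (\<lambda>_. bernoulli_pmf p))"
    unfolding Pi_pmf_subset[OF assms(1,2)] map_pmf_comp
    by (intro map_pmf_cong refl arg_cong[where f = card]) auto
  finally show ?thesis ..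
qed

lemma map_pmf_card_cut_arcs:
  assumes "p \<in> {0..1}" and "S \<subseteq> {1..n}"
  shows "map_pmf (\<lambda>G. card (cut_arcs G S)) (random_dag n p)
    = binomial_pmf (card S * (n - card S)) p"
proof -
  have "cut_pairs n S \<subseteq> dag_pairs n" by (auto simp: cut_pairs_def)
  from map_pmf_card_Pi_pmf_bernoulli[OF finite_dag_pairs this assms(1)]
  have "map_pmf (\<lambda>f. card {x \<in> cut_pairs n S. f x})
      (Pi_pmf (dag_pairs n) False (\<lambda>_. bernoulli_pmf p)) = binomial_pmf (card S * (n - card S)) p"
    by (simp add: card_cut_pairs[OF assms(2)])
  moreover have "map_pmf (\<lambda>G. card (cut_arcs G S)) (random_dag n p)
      = map_pmf (\<lambda>f. card {x \<in> cut_pairs n S. f x})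
          (Pi_pmf (dag_pairs n) False (\<lambda>_. bernoulli_pmf p))"
    unfolding random_dag_def map_pmf_comp
    by (intro map_pmf_cong refl arg_cong[where f = card]) (auto simp: cut_arcs_def cut_pairs_def)
  ultimately show ?thesis by simp
qed

section \<open>Concentration of all cuts at once\<close>

lemma four_mult_diff_le_square:
  fixes s n :: real
  shows "4 * (s * (n - s)) \<le> n\<^sup>2"
  using zero_le_power2[of "n - 2 * s"] by (simp add: power2_eq_square algebra_simps)

lemma prob_cut_deviation_le:
  fixes t :: real
  assumes p: "p \<in> {0..1}" and S: "S \<subseteq> {1..n}" and "t \<ge> 0"
  shows "measure_pmf.prob (random_dag n p)
      {G. \<bar>real (card (cut_arcs G S)) - p * (real (card S) * (real n - real (card S)))\<bar> > t}
    \<le> 2 * exp (- (8 * t\<^sup>2 / (real n)\<^sup>2))"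
proof -
  define m where "m = card S * (n - card S)"
  have "card S \<le> n" using card_mono[OF _ S] by simp
  then have m: "real m = real (card S) * (real n - real (card S))"
    by (simp add: m_def of_nat_diff)
  have "measure_pmf.prob (random_dag n p)
      {G. \<bar>real (card (cut_arcs G S)) - p * (real (card S) * (real n - real (card S)))\<bar> > t}
    = measure_pmf.prob (map_pmf (\<lambda>G. card (cut_arcs G S)) (random_dag n p))
        {x. \<bar>real x - real m * p\<bar> > t}"
    by (simp add: m vimage_def mult.commute)
  also have "\<dots> = measure_pmf.prob (binomial_pmf m p) {x. \<bar>real x - real m * p\<bar> > t}"
    by (simp only: map_pmf_card_cut_arcs[OF p S] m_def)
  also have "\<dots> \<le> 2 * exp (- (8 * t\<^sup>2 / (real n)\<^sup>2))"
  \<comment> \<open>Without trials the count is surely 0, and the strict inequality makes the event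
    null. Hoeffding's exponent, divided by \<open>m = 0\<close>, would only give the bound
    2.\<close>
  proof (cases "m = 0")
    case True
    then show ?thesis using \<open>t \<ge> 0\<close> p by (simp add: binomial_pmf_0 indicator_def)
  next
    case False
    interpret binomial_distribution m p by standard (rule p)
    have "measure_pmf.prob (binomial_pmf m p) {x. \<bar>real x - real m * p\<bar> > t}
        \<le> measure_pmf.prob (binomial_pmf m p) {x. \<bar>real x - real m * p\<bar> \<ge> t}"
      by (intro measure_pmf.finite_measure_mono) auto
    also have "\<dots> \<le> 2 * exp (- 2 * t\<^sup>2 / real m)"
      using False \<open>t \<ge> 0\<close> by (intro prob_abs_ge) auto
    also have "\<dots> \<le> 2 * exp (- (8 * t\<^sup>2 / (real n)\<^sup>2))"
    proof -
      \<comment> \<open>A cut has at most a quarter of \<open>n\<^sup>2\<close> pairs, which makes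
        Hoeffding's bound uniform in \<open>S\<close>.\<close>
      have "4 * real m \<le> (real n)\<^sup>2"
        unfolding m by (rule four_mult_diff_le_square)
      then have "8 * t\<^sup>2 / (real n)\<^sup>2 \<le> 8 * t\<^sup>2 / (4 * real m)"
        using False by (intro divide_left_mono) (auto simp: m_def)
      then show ?thesis by simp
    qed
    finally show ?thesis .
  qed
  finally show ?thesis .
qed

text \<open>Which sets are prefixes of layouts depends on the graph. Ranging over all vertex sets
  gives the union bound a fixed family of \<open>2 ^ n\<close> events.\<close>

definition cuts_concentrated :: "nat \<Rightarrow> real \<Rightarrow> real \<Rightarrow> nat pair_pre_digraph \<Rightarrow> bool" where
  "cuts_concentrated n p t G \<longleftrightarrow> (\<forall>S \<subseteq> {1..n}.
     \<bar>real (card (cut_arcs G S)) - p * (real (card S) * (real n - real (card S)))\<bar> \<le> t)"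

lemma prob_cuts_concentrated_ge:
  fixes t :: real
  assumes p: "p \<in> {0..1}" and "t \<ge> 0"
  shows "measure_pmf.prob (random_dag n p) {G. cuts_concentrated n p t G}
    \<ge> 1 - 2 ^ n * (2 * exp (- (8 * t\<^sup>2 / (real n)\<^sup>2)))"
proof -
  let ?bad = "\<lambda>S. {G :: nat pair_pre_digraph.
    \<bar>real (card (cut_arcs G S)) - p * (real (card S) * (real n - real (card S)))\<bar> > t}"
  let ?M = "random_dag n p"
  have "measure_pmf.prob ?M (\<Union>S\<in>Pow {1..n}. ?bad S)
      \<le> (\<Sum>S\<in>Pow {1..n}. measure_pmf.prob ?M (?bad S))"
    by (intro measure_pmf.finite_measure_subadditive_finite) auto
  also have "\<dots> \<le> (\<Sum>S\<in>Pow {1..n}. 2 * exp (- (8 * t\<^sup>2 / (real n)\<^sup>2)))"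
    by (intro sum_mono prob_cut_deviation_le) (use assms in auto)
  also have "\<dots> = 2 ^ n * (2 * exp (- (8 * t\<^sup>2 / (real n)\<^sup>2)))"
    by (simp add: card_Pow)
  finally have "measure_pmf.prob ?M (\<Union>S\<in>Pow {1..n}. ?bad S) \<le> \<dots>" .
  moreover have "{G. cuts_concentrated n p t G} = UNIV - (\<Union>S\<in>Pow {1..n}. ?bad S)"
    by (auto simp: cuts_concentrated_def not_less)
  ultimately show ?thesis
    using measure_pmf.prob_compl[of "\<Union>S\<in>Pow {1..n}. ?bad S" ?M] by simp
qed

section \<open>Cutwidths of layouts under concentrated cuts\<close>

lemma \<theta>_eq_card_cut_arcs:
  assumes "layout G \<phi>" and "parcs G \<subseteq> pverts G \<times> pverts G"
  shows "\<theta> i \<phi> G = card (cut_arcs G {v \<in> pverts G. \<phi> v \<le> i})"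
  unfolding \<theta>_def cut_arcs_def
  \<comment> \<open>Arcs ascend along \<phi>, so none enters the prefix from outside. As they stay
    in \<open>pverts G\<close>, an endpoint outside the prefix has position above
    \<open>i\<close>.\<close>
  by (rule arg_cong[where f = card]) (use assms in \<open>fastforce simp: layout_def\<close>)

lemma card_layout_prefix:
  assumes "layout G \<phi>" and "i \<le> card (pverts G)"
  shows "card {v \<in> pverts G. \<phi> v \<le> i} = i"
proof -
  have bij: "bij_betw \<phi> (pverts G) {1..card (pverts G)}"
    using assms by (simp add: layout_def)
  have "\<phi> ` {v \<in> pverts G. \<phi> v \<le> i} = {1..i}"
  proof -
    have "\<phi> ` {v \<in> pverts G. \<phi> v \<le> i} = \<phi> ` pverts G \<inter> {..i}" by auto
    also have "\<dots> = {1..i}" using bij_betw_imp_surj_on[OF bij] assms(2) by auto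
    finally show ?thesis .
  qed
  moreover have "inj_on \<phi> {v \<in> pverts G. \<phi> v \<le> i}"
    using bij by (auto simp: bij_betw_def inj_on_def)
  ultimately show ?thesis by (metis card_atLeastAtMost card_image diff_Suc_1)
qed

text \<open>The upper bound comes from a cut attaining the maximum, the lower one from the middle
  cut alone. The term \<open>1 / 4\<close> pays for odd \<open>n\<close>.\<close>

lemma CW_bounds_if_cuts_concentrated:
  assumes conc: "cuts_concentrated n p t G" and "0 \<le> p" "p \<le> 1" and "n \<ge> 2"
    and V: "pverts G = {1..n}" and A: "parcs G \<subseteq> dag_pairs n" and lay: "layout G \<phi>"
  shows "real (CW G \<phi>) \<le> p * (real n)\<^sup>2 / 4 + t"
    and "p * (real n)\<^sup>2 / 4 - 1 / 4 - t \<le> real (CW G \<phi>)"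
proof -
  have sub: "parcs G \<subseteq> pverts G \<times> pverts G"
    using V A by (auto simp: dag_pairs_def)
  have th: "\<bar>real (\<theta> i \<phi> G) - p * (real i * (real n - real i))\<bar> \<le> t" if "i \<le> n" for i
  proof -
    let ?S = "{v \<in> pverts G. \<phi> v \<le> i}"
    have "card ?S = i"
      using card_layout_prefix[OF lay] that V by simp
    moreover have "?S \<subseteq> {1..n}"
      unfolding V by blast
    ultimately show ?thesis
      using conc[unfolded cuts_concentrated_def, rule_format, of ?S]
      by (simp only: \<theta>_eq_card_cut_arcs[OF lay sub])
  qed
  have "CW G \<phi> \<in> (\<lambda>i. \<theta> i \<phi> G) ` {1..n}"
    unfolding CW_def V using \<open>n \<ge> 2\<close> Max_in[of "(\<lambda>i. \<theta> i \<phi> G) ` {1..n}"] by simp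
  then obtain i where i: "CW G \<phi> = \<theta> i \<phi> G" "i \<le> n" by auto
  have "p * (4 * (real i * (real n - real i))) \<le> p * (real n)\<^sup>2"
    using \<open>0 \<le> p\<close> by (intro mult_left_mono four_mult_diff_le_square)
  then show "real (CW G \<phi>) \<le> p * (real n)\<^sup>2 / 4 + t"
    using th[OF i(2)] i(1) by simp
  \<comment> \<open>The middle prefix nearly maximises the mean; \<open>n \<ge> 2\<close> ensures
    that \<open>h\<close> is at least 1, hence an admissible index.\<close>
  define h where "h = n div 2"
  have "\<theta> h \<phi> G \<le> CW G \<phi>"
    unfolding CW_def V h_def using \<open>n \<ge> 2\<close> by (intro Max_ge) auto
  moreover have "p * (real n)\<^sup>2 - 1 \<le> p * (4 * (real h * (real n - real h)))"
  proof -
    \<comment> \<open>The difference \<open>n\<^sup>2 - 4 * h * (n - h)\<close> equals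
      \<open>(n - 2 * h)\<^sup>2\<close>, so only parity causes a loss.\<close>
    have "n = 2 * h \<or> n = 2 * h + 1" by (auto simp: h_def)
    then have "(real n - 2 * real h)\<^sup>2 \<le> 1" by auto
    then have "p * (real n - 2 * real h)\<^sup>2 \<le> 1"
      using assms(2,3) mult_mono[of p 1 "(real n - 2 * real h)\<^sup>2" 1] by simp
    then show ?thesis by (simp add: power2_eq_square algebra_simps)
  qed
  ultimately show "p * (real n)\<^sup>2 / 4 - 1 / 4 - t \<le> real (CW G \<phi>)"
    using th[of h] by (simp add: h_def)
qed

text \<open>The layout \<psi> makes the finite set of cutwidths nonempty, so \<open>Min\<close> and
  \<open>Max\<close> are attained and inherit the bounds. Positivity of \<open>MINCW G\<close>
  excludes the degenerate quotient \<open>0 / 0\<close>.\<close>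

lemma GAPCW_less_if_CW_bounds:
  fixes a b :: real
  assumes G: "finite (parcs G)" "finite (pverts G)" "pverts G \<noteq> {}" and lay: "layout G \<psi>"
    and le: "\<And>\<phi>. layout G \<phi> \<Longrightarrow> real (CW G \<phi>) \<le> b"
    and ge: "\<And>\<phi>. layout G \<phi> \<Longrightarrow> a \<le> real (CW G \<phi>)"
    and "0 < a" and "b < d * a"
  shows "MINCW G > 0" and "GAPCW G < d"
proof -
  have fin: "finite (CW G ` {\<phi>. layout G \<phi>})" and ne: "CW G ` {\<phi>. layout G \<phi>} \<noteq> {}"
    using finite_CW_layouts[OF G] lay by auto
  have a: "a \<le> real (MINCW G)"
    using Min_in[OF fin ne] ge unfolding MINCW_def by auto
  then show "MINCW G > 0" using \<open>0 < a\<close> by simp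
  have b: "real (MAXCW G) \<le> b"
    using Max_in[OF fin ne] le unfolding MAXCW_def by auto
  \<comment> \<open>Positivity of \<open>d\<close> lets \<open>a\<close> be replaced by the larger
    \<open>MINCW G\<close> in \<open>b < d * a\<close>.\<close>
  have "0 \<le> b" using b by (meson of_nat_0_le_iff order_trans)
  then have "0 < d" using \<open>0 < a\<close> \<open>b < d * a\<close>
    by (smt (verit) mult_nonpos_nonneg)
  then have "b < d * real (MINCW G)"
    using a \<open>b < d * a\<close> by (smt (verit) mult_left_mono)
  then show "GAPCW G < d"
    using a b \<open>0 < a\<close> by (simp add: GAPCW_def divide_less_eq)
qed

section \<open>Choice of constants and asymptotics\<close>

theorem theorem2:
  fixes c :: real and p :: "nat \<Rightarrow> real"
  assumes "0 \<le> c" and "c < 1/2"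
    and "\<And>n. n \<ge> 1 \<Longrightarrow> 0 \<le> p n \<and> p n \<le> 1"
    and "\<exists>k>0. \<exists>n0. \<forall>n\<ge>n0. p n \<ge> k * real n powr (-c)"
  shows "\<forall>\<epsilon>>0. \<forall>\<delta>>0. \<exists>N. \<forall>n\<ge>N.
    measure_pmf.prob (random_dag n (p n)) {G. MINCW G > 0 \<and> GAPCW G < 1 + \<delta>} > 1 - \<epsilon>"
proof (intro allI impI)
  fix \<epsilon> \<delta> :: real
  assume "\<epsilon> > 0" and "\<delta> > 0"
  obtain k n0 where "k > 0" and pk: "\<And>n. n \<ge> n0 \<Longrightarrow> p n \<ge> k * real n powr (-c)"
    using assms(4) by blast
  \<comment> \<open>The cap by 1 keeps \<open>1 / 4 - 2 * \<eta>\<close> positive and controls the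
    product of \<delta> and \<eta>.\<close>
  define \<eta> where "\<eta> = min 1 \<delta> / 40"
  have \<eta>: "0 < \<eta>" "\<eta> \<le> 1 / 40" "40 * \<eta> \<le> \<delta>"
    using \<open>\<delta> > 0\<close> by (auto simp: \<eta>_def)
  \<comment> \<open>Through \<open>p n \<ge> k * n powr (-c)\<close>, the first limit drives the
    Hoeffding exponent per vertex, with \<open>1 - 2 * c > 0\<close>; the second makes the parity
    loss negligible; the third is the final failure bound.\<close>
  have lim1: "filterlim (\<lambda>n. 8 * \<eta>\<^sup>2 * k\<^sup>2 * real n powr (1 - 2 * c)) at_top sequentially"
    using assms(2) \<eta>(1) \<open>k > 0\<close> by real_asymp
  have lim2: "filterlim (\<lambda>n. 4 * \<eta> * k * real n powr (2 - c)) at_top sequentially"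
    using assms(2) \<eta>(1) \<open>k > 0\<close> by real_asymp
  have lim3: "((\<lambda>n. 2 * exp (- real n)) \<longlongrightarrow> 0) sequentially"
    by real_asymp
  have "\<forall>\<^sub>F n in sequentially.
      measure_pmf.prob (random_dag n (p n)) {G. MINCW G > 0 \<and> GAPCW G < 1 + \<delta>} > 1 - \<epsilon>"
    using filterlim_at_top[THEN iffD1, OF lim1, rule_format, of 2]
      filterlim_at_top[THEN iffD1, OF lim2, rule_format, of 1]
      order_tendstoD(2)[OF lim3 \<open>\<epsilon> > 0\<close>] eventually_ge_at_top[of n0] eventually_ge_at_top[of 2]
  proof eventually_elim
    case (elim n)
    define q where "q = p n"
    define t where "t = \<eta> * (q * (real n)\<^sup>2)"
    have n: "real n > 0" and q: "0 \<le> q" "q \<le> 1"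
      using elim assms(3)[of n] by (auto simp: q_def)
    have qk: "k * real n powr (-c) \<le> q" using pk elim by (simp add: q_def)
    \<comment> \<open>Equivalently, the parity loss \<open>1 / 4\<close> is at most
      \<open>t\<close>; this is the second \<eta> in the lower bound
      \<open>1 / 4 - 2 * \<eta>\<close>.\<close>
    have large: "1 \<le> 4 * (\<eta> * (q * (real n)\<^sup>2))"
    proof -
      have "4 * \<eta> * k * real n powr (2 - c) = 4 * \<eta> * ((k * real n powr (-c)) * (real n)\<^sup>2)"
        using n by (simp add: powr_diff powr_minus powr_numeral field_simps)
      also have "\<dots> \<le> 4 * \<eta> * (q * (real n)\<^sup>2)"
        using \<eta> qk by (intro mult_left_mono mult_right_mono) auto
      finally show ?thesis using elim by simp
    qed
    \<comment> \<open>The threshold 2 yields a Hoeffding exponent of at least \<open>2 * n\<close>: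
      one \<open>n\<close> absorbs the \<open>2 ^ n\<close> sets, the other leaves
      \<open>exp (- n)\<close>.\<close>
    have "2 \<le> 8 * \<eta>\<^sup>2 * (q\<^sup>2 * real n)"
    proof -
      have "real n powr (1 - 2 * c) = (real n powr (-c))\<^sup>2 * real n"
        using n by (simp add: powr_diff powr_minus power2_eq_square field_simps flip: powr_add)
      then have "8 * \<eta>\<^sup>2 * k\<^sup>2 * real n powr (1 - 2 * c)
          = 8 * \<eta>\<^sup>2 * ((k * real n powr (-c))\<^sup>2 * real n)"
        by (simp add: power_mult_distrib)
      also have "\<dots> \<le> 8 * \<eta>\<^sup>2 * (q\<^sup>2 * real n)"
        using \<open>k > 0\<close> qk by (intro mult_left_mono mult_right_mono power_mono) auto
      finally show ?thesis using elim by linarith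
    qed
    then have "2 * real n \<le> 8 * \<eta>\<^sup>2 * (q\<^sup>2 * real n) * real n"
      using n by (intro mult_right_mono) auto
    also have "\<dots> = 8 * t\<^sup>2 / (real n)\<^sup>2"
      using n by (simp add: t_def power2_eq_square field_simps)
    finally have "exp (- (8 * t\<^sup>2 / (real n)\<^sup>2)) \<le> exp (- (2 * real n))" by simp
    moreover have "(2::real) ^ n \<le> exp (real n)"
    proof -
      have "(2::real) \<le> exp 1" using exp_ge_add_one_self[of 1] by simp
      then have "(2::real) ^ n \<le> exp 1 ^ n" by (intro power_mono) auto
      then show ?thesis by (simp flip: exp_of_nat_mult)
    qed
    ultimately have "2 ^ n * (2 * exp (- (8 * t\<^sup>2 / (real n)\<^sup>2)))
        \<le> exp (real n) * (2 * exp (- (2 * real n)))"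
      by (intro mult_mono) auto
    also have "\<dots> = 2 * exp (- real n)" by (simp flip: exp_add)
    also have "\<dots> < \<epsilon>" using elim by simp
    finally have "1 - \<epsilon> < 1 - 2 ^ n * (2 * exp (- (8 * t\<^sup>2 / (real n)\<^sup>2)))" by simp
    also have "\<dots> \<le> measure_pmf.prob (random_dag n q) {G. cuts_concentrated n q t G}"
      using q \<eta> by (intro prob_cuts_concentrated_ge) (auto simp: t_def)
    also have "\<dots> \<le> measure_pmf.prob (random_dag n q) {G. MINCW G > 0 \<and> GAPCW G < 1 + \<delta>}"
    \<comment> \<open>The implication between the events is shown only on the support, where the
      vertices are \<open>{1..n}\<close>, arcs ascend and \<open>id\<close> is a layout.\<close>
    proof (rule measure_pmf.finite_measure_mono_AE)
      show "AE G in random_dag n q. G \<in> {G. cuts_concentrated n q t G}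
          \<longrightarrow> G \<in> {G. MINCW G > 0 \<and> GAPCW G < 1 + \<delta>}"
      proof (intro AE_pmfI impI)
        fix G assume G: "G \<in> set_pmf (random_dag n q)"
          and "G \<in> {G. cuts_concentrated n q t G}"
        then have conc: "cuts_concentrated n q t G" by simp
        note G' = set_random_dag[OF G]
        define x where "x = q * (real n)\<^sup>2"
        have "0 < \<eta> * x" using large unfolding x_def by linarith
        then have "x > 0" using \<eta>(1) by (rule zero_less_mult_pos)
        have bounds: "real (CW G \<phi>) \<le> (1 / 4 + \<eta>) * x" "(1 / 4 - 2 * \<eta>) * x \<le> real (CW G \<phi>)"
          if "layout G \<phi>" for \<phi>
          using CW_bounds_if_cuts_concentrated[OF conc q elim(5) G'(1,2) that] large
          unfolding t_def x_def[symmetric] left_diff_distrib distrib_right by linarith+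
        \<comment> \<open>Right minus left is
          \<open>\<delta> / 4 - 3 * \<eta> - 2 * \<delta> * \<eta>\<close>; the subtracted terms are
          at most \<open>3 * \<delta> / 40\<close> and \<open>\<delta> / 20\<close>, so
          \<open>\<delta> / 8\<close> remains.\<close>
        have "1 / 4 + \<eta> < (1 + \<delta>) * (1 / 4 - 2 * \<eta>)"
        proof -
          have "\<delta> * \<eta> \<le> \<delta> * (1 / 40)" using \<eta> \<open>\<delta> > 0\<close> by (intro mult_left_mono) auto
          moreover have "(1 + \<delta>) * (1 / 4 - 2 * \<eta>) = 1 / 4 + \<delta> / 4 - 2 * \<eta> - 2 * (\<delta> * \<eta>)"
            by (simp add: algebra_simps)
          ultimately show ?thesis using \<eta> \<open>\<delta> > 0\<close> by linarith
        qed
        then have "(1 / 4 + \<eta>) * x < (1 + \<delta>) * ((1 / 4 - 2 * \<eta>) * x)"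
          unfolding mult.assoc[symmetric] using \<open>x > 0\<close> by (rule mult_strict_right_mono)
        moreover have "0 < (1 / 4 - 2 * \<eta>) * x" using \<open>x > 0\<close> \<eta> by simp
        moreover have "finite (parcs G)" "finite (pverts G)" "pverts G \<noteq> {}"
          using elim(5) finite_subset[OF G'(2) finite_dag_pairs] by (simp_all add: G'(1))
        ultimately show "G \<in> {G. MINCW G > 0 \<and> GAPCW G < 1 + \<delta>}"
          using GAPCW_less_if_CW_bounds[OF _ _ _ G'(4) bounds] by blast
      qed
    qed simp
    finally show ?case by (simp add: q_def)
  qed
  then show "\<exists>N. \<forall>n\<ge>N.
    measure_pmf.prob (random_dag n (p n)) {G. MINCW G > 0 \<and> GAPCW G < 1 + \<delta>} > 1 - \<epsilon>"
    by (simp add: eventually_sequentially)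
qed

end
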